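(* Let $(X,\mathcal A,\mu,T)$ be a measure preserving system. For $\ell\in\mathbb N$, $\epsilon>0$ and $A_0,\dots,A_\ell\in\mathcal A$ let $$R_\epsilon(A_0,\dots,A_\ell)=\Big\{(n_1,\dots,n_\ell)\in\mathbb Z^\ell : \Big|\mu(A_0\cap T^{n_1}A_1\cap\cdots\cap T^{n_\ell}A_\ell)-\prod_{j=0}^\ell\mu(A_j)\Big|<\epsilon\Big\}.$$ The following statements are equivalent: (i) $T$ is strongly mixing. (ii) For any $\ell\in\mathbb N$, any $A_0,\dots,A_\ell\in\mathcal A$ and any $\epsilon>0$, the set $R_\epsilon(A_0,\dots,A_\ell)$ is $\tilde\Sigma_\ell^*$ in $\mathbb Z^\ell$. (iii) There exists an $\ell\in\mathbb N$ such that for any $A_0,\dots,A_\ell\in\mathcal A$ and any $\epsilon>0$, the set $R_\epsilon(A_0,\dots,A_\ell)$ is $\tilde\Sigma_\ell^*$ in $\mathbb Z^\ell$.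
   Context: $\mathbb N=\{1,2,\dots\}$. Here $(X,\mathcal A,\mu)$ is a separable probability space (by standing assumption regular: $X$ is a compact metric space and $\mathcal A=\mathrm{Borel}(X)$) and $T:X\to X$ is an invertible $\mu$-preserving transformation. $T$ is strongly mixing if $\lim_{|n|\to\infty}\mu(A_0\cap T^nA_1)=\mu(A_0)\mu(A_1)$ for all $A_0,A_1\in\mathcal A$. For a sequence of integers, "$\to\infty$" means that absolute values tend to infinity. A set $E\subseteq\mathbb Z^d$ is a $\tilde\Sigma_m$ set if $E=\{\mathbf n^{(1)}_{k_1}+\cdots+\mathbf n^{(m)}_{k_m} : k_1<\cdots<k_m\}$ (with $k_1,\dots,k_m\in\mathbb N$) where for each $j\in\{1,\dots,m\}$, $(\mathbf n^{(j)}_k)_{k\in\mathbb N}=(n^{(j)}_{k,1},\dots,n^{(j)}_{k,d})_{k\in\mathbb N}$ is a sequence in $\mathbb Z^d$ such that $\lim_{k\to\infty}n^{(j)}_{k,t}=\infty$ for each $t\in\{1,\dots,d\}$ and $\lim_{k\to\infty}(n^{(j)}_{k,t}-n^{(j)}_{k,t'})=\infty$ for distinct $t,t'\in\{1,\dots,d\}$. A subset of $\mathbb Z^d$ is $\tilde\Sigma_m^*$ if it has non-empty intersection with every $\tilde\Sigma_m$ set in $\mathbb Z^d$. *)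

theory Defs
  imports "HOL-Probability.Probability"
begin

section \<open>Measure preserving systems\<close>

text \<open>
  The compact metric space is the set \<open>space M\<close>, an arbitrary compact subset of an arbitrary
  metric type. Separability and regularity of the measure are then automatic.
  Invertible means: a bijection of the space onto itself, measurable in both directions.
\<close>

locale invertible_mps = prob_space M for M :: "'a::metric_space measure" +
  fixes T :: "'a \<Rightarrow> 'a"
  assumes compact_space: "compact (space M)"
    and sets_borel: "sets M = sets (restrict_space borel (space M))"
    and T_bij: "bij_betw T (space M) (space M)"
    and T_measurable: "T \<in> measurable M M"
    and T_inv_measurable: "inv_into (space M) T \<in> measurable M M"
    and T_preserves: "distr M M T = M"

definition int_iter :: "'a set \<Rightarrow> ('a \<Rightarrow> 'a) \<Rightarrow> int \<Rightarrow> 'a \<Rightarrow> 'a" where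
  "int_iter X T n = (if 0 \<le> n then T ^^ nat n else inv_into X T ^^ nat (- n))"

definition strongly_mixing :: "'a measure \<Rightarrow> ('a \<Rightarrow> 'a) \<Rightarrow> bool" where
  "strongly_mixing M T \<longleftrightarrow>
     (\<forall>A0\<in>sets M. \<forall>A1\<in>sets M.
        ((\<lambda>n::int. measure M (A0 \<inter> int_iter (space M) T n ` A1))
           \<longlongrightarrow> measure M A0 * measure M A1) (filtercomap abs at_top))"

section \<open>The families \<open>\<Sigma>\<^sub>m\<close>-tilde and their duals in integer lattices\<close>

text \<open>Points of the \<open>d\<close>-dimensional integer lattice, with coordinates indexed by \<open>1, \<dots>, d\<close>
  (and the value \<open>undefined\<close> outside, so that equality of points is equality of coordinates).\<close>

definition int_lattice :: "nat \<Rightarrow> (nat \<Rightarrow> int) set" where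
  "int_lattice d = {1..d} \<rightarrow>\<^sub>E UNIV"

text \<open>Sequences are indexed by the positive integers; the value at index 0 is never used.
  The coordinate \<open>t\<close> of the \<open>k\<close>-th term of the \<open>j\<close>-th sequence is \<open>s j k t\<close>.
  Tending to infinity refers to absolute values.\<close>

definition abs_to_infinity :: "(nat \<Rightarrow> int) \<Rightarrow> bool" where
  "abs_to_infinity u \<longleftrightarrow> filterlim (\<lambda>k. \<bar>u k\<bar>) at_top sequentially"

definition is_tilde_Sigma :: "nat \<Rightarrow> nat \<Rightarrow> (nat \<Rightarrow> int) set \<Rightarrow> bool" where
  "is_tilde_Sigma d m E \<longleftrightarrow>
     (\<exists>s :: nat \<Rightarrow> nat \<Rightarrow> nat \<Rightarrow> int.
        (\<forall>j\<in>{1..m}.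
           (\<forall>k\<ge>1. s j k \<in> int_lattice d) \<and>
           (\<forall>t\<in>{1..d}. abs_to_infinity (\<lambda>k. s j k t)) \<and>
           (\<forall>t\<in>{1..d}. \<forall>t'\<in>{1..d}. t \<noteq> t' \<longrightarrow> abs_to_infinity (\<lambda>k. s j k t - s j k t'))) \<and>
        E = {\<lambda>t\<in>{1..d}. \<Sum>j=1..m. s j (\<kappa> j) t | \<kappa> :: nat \<Rightarrow> nat.
               (\<forall>j\<in>{1..m}. 1 \<le> \<kappa> j) \<and> strict_mono_on {1..m} \<kappa>})"

definition is_tilde_Sigma_star :: "nat \<Rightarrow> nat \<Rightarrow> (nat \<Rightarrow> int) set \<Rightarrow> bool" where
  "is_tilde_Sigma_star d m F \<longleftrightarrow>
     F \<subseteq> int_lattice d \<and> (\<forall>E. is_tilde_Sigma d m E \<longrightarrow> F \<inter> E \<noteq> {})"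

section \<open>Sets of multiple returns\<close>

definition return_set ::
    "'a measure \<Rightarrow> ('a \<Rightarrow> 'a) \<Rightarrow> nat \<Rightarrow> real \<Rightarrow> (nat \<Rightarrow> 'a set) \<Rightarrow> (nat \<Rightarrow> int) set" where
  "return_set M T l \<epsilon> A =
     {n \<in> int_lattice l.
        \<bar>measure M (A 0 \<inter> (\<Inter>j\<in>{1..l}. int_iter (space M) T (n j) ` A j))
           - (\<Prod>j=0..l. measure M (A j))\<bar> < \<epsilon>}"

end

theory Submission
  imports Defs "HOL-Library.Ramsey"
begin

text \<open>
  Both directions rest on one second moment argument: if the events \<open>B\<^sub>1, \<dots>, B\<^sub>N\<close> all have measure
  close to \<open>c\<close> and are almost pairwise independent, then, for large \<open>N\<close>, any given event \<open>A\<close> is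
  almost independent of one of them (\<open>almost_independent_of_some_event\<close>). Ramsey's theorem
  turns statements about single increasing tuples of indices into statements about all tuples from
  an infinite set of indices.

  Suppose that \<open>T\<close> is strongly mixing, and consider the intersection of the sets \<open>T\<^sup>n\<^sub>t A\<^sub>t\<close>, where
  \<open>n\<^sub>t\<close> is the \<open>t\<close>-th coordinate of a sum of \<open>l\<close> terms with increasing indices. Let only the first
  index vary. Two of the resulting intersections over \<open>t \<ge> 1\<close> meet in an intersection of the
  same kind, with \<open>A\<^sub>t\<close> replaced by \<open>A\<^sub>t \<inter> T\<^sup>d A\<^sub>t\<close> and one summand and one free coordinate fewer. By
  induction on \<open>l\<close> the measure of this is close to the product of the \<open>\<mu>(A\<^sub>t \<inter> T\<^sup>d A\<^sub>t)\<close>, which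
  mixing brings close to the square of the product of the \<open>\<mu>(A\<^sub>t)\<close>. Hence the second moment
  argument applies and makes one of these intersections almost independent of \<open>A\<^sub>0\<close>
  (\<open>mixing_along_increasing_sums\<close>).

  Conversely, suppose that \<open>A\<close> stays correlated with \<open>T\<^sup>n B\<close> along a sequence of integers \<open>n\<close> tending
  to infinity. Then the sets \<open>T\<^sup>n B\<close> cannot be almost pairwise independent, so that \<open>B\<close> is correlated
  with \<open>T\<^sup>n B\<close> for differences \<open>n\<close> of terms of the sequence, and by Ramsey's theorem for all
  differences over an infinite set of indices. Iterating this gives correlations along sums of
  \<open>2\<^sup>r\<close> terms, hence along sums of exactly \<open>l\<close> terms (\<open>correlated_increasing_sums\<close>). These are the
  first coordinates of a set that violates the hypothesis on return sets.
\<close>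

section \<open>Increasing tuples and Ramsey's theorem\<close>

definition increasing_tuples :: "nat set \<Rightarrow> nat \<Rightarrow> nat list set" where
  "increasing_tuples Y m = {ks. length ks = m \<and> sorted_wrt (<) ks \<and> set ks \<subseteq> Y}"

text \<open>
  The sequences are numbered from 0, so that removing the first index of a tuple shifts their
  numbering by one.
\<close>

definition selected_sum :: "(nat \<Rightarrow> nat \<Rightarrow> int) \<Rightarrow> nat list \<Rightarrow> int" where
  "selected_sum u ks = (\<Sum>i<length ks. u i (ks ! i))"

lemma selected_sum_Nil [simp]: "selected_sum u [] = 0"
  by (simp add: selected_sum_def)

lemma selected_sum_Cons [simp]:
  "selected_sum u (k # ks) = u 0 k + selected_sum (\<lambda>i. u (Suc i)) ks"
  by (simp add: selected_sum_def sum.lessThan_Suc_shift del: sum.lessThan_Suc)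

lemma selected_sum_append:
  "selected_sum u (xs @ ys) = selected_sum u xs + selected_sum (\<lambda>i. u (length xs + i)) ys"
  by (induction xs arbitrary: u) auto

lemma increasing_tuples_mono: "Y \<subseteq> Z \<Longrightarrow> increasing_tuples Y m \<subseteq> increasing_tuples Z m"
  by (auto simp: increasing_tuples_def)

lemma increasing_tuple_exists:
  assumes "infinite Y"
  shows "increasing_tuples Y m \<noteq> {}"
proof -
  obtain B where "finite B" "card B = m" "B \<subseteq> Y"
    using infinite_arbitrarily_large[OF assms] by blast
  then have "sorted_list_of_set B \<in> increasing_tuples Y m"
    by (auto simp: increasing_tuples_def)
  then show ?thesis by blast
qed

lemma Ramsey_increasing_tuples:
  assumes "infinite Z"
  obtains Y where "Y \<subseteq> Z" "infinite Y" "\<forall>ks\<in>increasing_tuples Y m. P ks"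
    | Y where "Y \<subseteq> Z" "infinite Y" "\<forall>ks\<in>increasing_tuples Y m. \<not> P ks"
proof -
  \<comment> \<open>A finite set of naturals is the same as an increasing tuple, so a property of tuples is a
    2-colouring of finite sets.\<close>
  define f where "f X = (if P (sorted_list_of_set X) then 0 else 1 :: nat)" for X
  have "\<forall>X. X \<subseteq> Z \<and> finite X \<and> card X = m \<longrightarrow> f X < 2"
    by (auto simp: f_def)
  from Ramsey[OF assms this] obtain Y c where Y: "Y \<subseteq> Z" "infinite Y"
    and c: "\<And>X. X \<subseteq> Y \<Longrightarrow> finite X \<Longrightarrow> card X = m \<Longrightarrow> f X = c" by metis
  have *: "f (set ks) = c" "sorted_list_of_set (set ks) = ks" if "ks \<in> increasing_tuples Y m" for ks
  proof -
    have ks: "length ks = m" "sorted ks" "distinct ks" "set ks \<subseteq> Y"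
      using that by (auto simp: increasing_tuples_def strict_sorted_iff)
    then show "sorted_list_of_set (set ks) = ks"
      by (simp add: sorted_list_of_set.idem_if_sorted_distinct)
    show "f (set ks) = c" using c ks distinct_card by force
  qed
  show thesis
  proof (cases "c = 0")
    case True
    then have "\<forall>ks\<in>increasing_tuples Y m. P ks"
      using * unfolding f_def by (metis one_neq_zero)
    with Y that(1) show thesis by blast
  next
    case False
    then have "\<forall>ks\<in>increasing_tuples Y m. \<not> P ks"
      using * unfolding f_def by metis
    with Y that(2) show thesis by blast
  qed
qed

text \<open>
  A property that every infinite set of indices realises in at least one tuple is, by Ramsey's
  theorem, realised by all tuples of a suitable infinite set; hence finitely many such properties
  can be realised at once.
\<close>

lemma common_increasing_tuple:
  assumes "finite I" "infinite Z"
    and ex: "\<And>i Y. i \<in> I \<Longrightarrow> infinite Y \<Longrightarrow> Y \<subseteq> Z \<Longrightarrow> \<exists>ks\<in>increasing_tuples Y m. P i ks"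
  shows "\<exists>ks\<in>increasing_tuples Z m. \<forall>i\<in>I. P i ks"
proof -
  have "\<exists>Y\<subseteq>Z. infinite Y \<and> (\<forall>i\<in>I. \<forall>ks\<in>increasing_tuples Y m. P i ks)"
    using assms(1) ex
  proof (induction I)
    case empty
    then show ?case using assms(2) by auto
  next
    case (insert x F)
    then obtain Y where Y: "Y \<subseteq> Z" "infinite Y" "\<forall>i\<in>F. \<forall>ks\<in>increasing_tuples Y m. P i ks"
      by (metis insertCI)
    show ?case
    proof (rule Ramsey_increasing_tuples[OF Y(2), of m "P x"])
      fix W assume W: "W \<subseteq> Y" "infinite W" "\<forall>ks\<in>increasing_tuples W m. P x ks"
      then have "\<forall>i\<in>insert x F. \<forall>ks\<in>increasing_tuples W m. P i ks"
        using Y(3) increasing_tuples_mono[OF W(1)] by blast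
      then show ?case using W Y by blast
    next
      fix W assume W: "W \<subseteq> Y" "infinite W" "\<forall>ks\<in>increasing_tuples W m. \<not> P x ks"
      then have False using insert.prems(1)[of x W] Y(1) by blast
      then show ?case ..
    qed
  qed
  then obtain Y where Y: "Y \<subseteq> Z" "infinite Y" "\<forall>i\<in>I. \<forall>ks\<in>increasing_tuples Y m. P i ks"
    by blast
  then show ?thesis
    using increasing_tuple_exists[OF Y(2), of m] increasing_tuples_mono[OF Y(1), of m] by blast
qed

text \<open>
  A relation that holds from each point to all sufficiently large ones cannot fail on all pairs of
  an infinite set.
\<close>

lemma pairwise_related_subset:
  fixes R :: "nat \<Rightarrow> nat \<Rightarrow> bool"
  assumes "infinite Z" and ev: "\<And>a. a \<in> Z \<Longrightarrow> eventually (\<lambda>b. R a b) sequentially"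
  shows "\<exists>K\<subseteq>Z. finite K \<and> card K = N \<and> (\<forall>a\<in>K. \<forall>b\<in>K. a < b \<longrightarrow> R a b)"
proof (rule Ramsey_increasing_tuples[OF assms(1), of 2 "\<lambda>ks. R (ks ! 0) (ks ! 1)"])
  fix Y assume Y: "Y \<subseteq> Z" "infinite Y" "\<forall>ks\<in>increasing_tuples Y 2. R (ks ! 0) (ks ! 1)"
  obtain K where K: "finite K" "card K = N" "K \<subseteq> Y"
    using infinite_arbitrarily_large[OF Y(2)] by blast
  have "R a b" if "a \<in> K" "b \<in> K" "a < b" for a b
  proof -
    have "[a, b] \<in> increasing_tuples Y 2" using that K by (auto simp: increasing_tuples_def)
    with Y(3) have "R ([a, b] ! 0) ([a, b] ! 1)" by blast
    then show ?thesis by simp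
  qed
  then show ?thesis using K Y by blast
next
  fix Y assume Y: "Y \<subseteq> Z" "infinite Y" "\<forall>ks\<in>increasing_tuples Y 2. \<not> R (ks ! 0) (ks ! 1)"
  obtain a where a: "a \<in> Y" using Y(2) by fastforce
  obtain n where n: "\<And>b. b \<ge> n \<Longrightarrow> R a b"
    using ev[of a] a Y(1) by (auto simp: eventually_sequentially)
  obtain b where b: "b \<in> Y" "b > max a n" using Y(2) unfolding infinite_nat_iff_unbounded by blast
  have "[a, b] \<in> increasing_tuples Y 2" using a b by (auto simp: increasing_tuples_def)
  with Y(3) have "\<not> R ([a, b] ! 0) ([a, b] ! 1)" by blast
  then show ?thesis using n b by simp
qed

section \<open>Events that are almost pairwise independent\<close>

text \<open>
  The second moment method: if the centred indicators of the \<open>B i\<close> are almost orthogonal, the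
  signed sum of \<open>n\<close> of them has \<open>L\<^sup>2\<close> norm small compared with \<open>n\<close>, so they cannot all be correlated with \<open>A\<close>.
  The signs are needed because the correlations may have either sign.
\<close>

lemma (in prob_space) almost_independent_of_some_event:
  fixes \<epsilon> c :: real
  assumes "finite I" "I \<noteq> {}" "0 < \<epsilon>" and card: "4 < \<epsilon>\<^sup>2 * card I" and c: "0 \<le> c" "c \<le> 1"
    and A: "A \<in> events" and B: "\<And>i. i \<in> I \<Longrightarrow> B i \<in> events"
    and B1: "\<And>i. i \<in> I \<Longrightarrow> \<bar>prob (B i) - c\<bar> \<le> \<epsilon>\<^sup>2 / 12"
    and B2: "\<And>i j. i \<in> I \<Longrightarrow> j \<in> I \<Longrightarrow> i \<noteq> j \<Longrightarrow> \<bar>prob (B i \<inter> B j) - c\<^sup>2\<bar> \<le> \<epsilon>\<^sup>2 / 12"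
  shows "\<exists>i\<in>I. \<bar>prob (A \<inter> B i) - c * prob A\<bar> < \<epsilon>"
proof (rule ccontr)
  assume "\<not> ?thesis"
  then have far: "\<epsilon> \<le> \<bar>prob (A \<inter> B i) - c * prob A\<bar>" if "i \<in> I" for i using that by force
  define \<sigma> where "\<sigma> i = sgn (prob (A \<inter> B i) - c * prob A)" for i
  define g where "g i x = indicator (B i) x - c" for i x
  define H where "H x = (\<Sum>i\<in>I. \<sigma> i * g i x)" for x
  define N where "N = real (card I)"
  have N: "N > 0" using assms(1,2) by (simp add: N_def card_gt_0_iff)
  note [measurable] = A B
  have gm [measurable]: "g i \<in> borel_measurable M" if "i \<in> I" for i
    using that unfolding g_def by measurable
  have Hm [measurable]: "H \<in> borel_measurable M" unfolding H_def by measurable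
  have \<sigma>: "\<bar>\<sigma> i\<bar> \<le> 1" for i by (simp add: \<sigma>_def sgn_if)
  have gb: "\<bar>g i x\<bar> \<le> 1" for i x using c by (auto simp: g_def indicator_def)
  have int_gg: "integrable M (\<lambda>x. g i x * g j x)" if "i \<in> I" "j \<in> I" for i j
    using that gb by (intro integrable_const_bound[where B=1])
      (auto simp: abs_mult intro!: mult_le_one)
  have int_Ag: "integrable M (\<lambda>x. indicator A x * g i x)" if "i \<in> I" for i
    using that gb by (intro integrable_const_bound[where B=1])
      (auto simp: abs_mult indicator_def)
  have ind: "integrable M (\<lambda>x. indicator E x :: real)" "(\<integral>x. indicator E x \<partial>M) = prob E"
    if "E \<in> events" for E
    using that by (auto simp: emeasure_eq_measure)
  have gg: "(\<integral>x. g i x * g j x \<partial>M) = prob (B i \<inter> B j) - c * prob (B i) - c * prob (B j) + c\<^sup>2"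
    if "i \<in> I" "j \<in> I" for i j
  proof -
    have "(\<integral>x. g i x * g j x \<partial>M)
        = (\<integral>x. indicator (B i \<inter> B j) x - c * indicator (B i) x - c * indicator (B j) x + c\<^sup>2 \<partial>M)"
      by (intro Bochner_Integration.integral_cong)
         (auto simp: g_def indicator_inter_arith algebra_simps power2_eq_square)
    also have "\<dots> = prob (B i \<inter> B j) - c * prob (B i) - c * prob (B j) + c\<^sup>2"
      using that ind by (simp add: prob_space)
    finally show ?thesis .
  qed
  have Ag: "(\<integral>x. indicator A x * g i x \<partial>M) = prob (A \<inter> B i) - c * prob A" if "i \<in> I" for i
  proof -
    have "(\<integral>x. indicator A x * g i x \<partial>M) = (\<integral>x. indicator (A \<inter> B i) x - c * indicator A x \<partial>M)"
      by (intro Bochner_Integration.integral_cong)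
         (auto simp: g_def indicator_inter_arith algebra_simps)
    also have "\<dots> = prob (A \<inter> B i) - c * prob A" using that A ind by simp
    finally show ?thesis .
  qed
  have HH: "H x * H x = (\<Sum>i\<in>I. \<Sum>j\<in>I. (\<sigma> i * \<sigma> j) * (g i x * g j x))" for x
    unfolding H_def sum_product by (intro sum.cong) auto
  have int_HH: "integrable M (\<lambda>x. H x * H x)"
    unfolding HH using int_gg by (intro Bochner_Integration.integrable_sum integrable_mult_right) auto
  have "(\<integral>x. H x * H x \<partial>M) = (\<Sum>i\<in>I. \<Sum>j\<in>I. (\<sigma> i * \<sigma> j) * (\<integral>x. g i x * g j x \<partial>M))"
    unfolding HH using int_gg by (simp add: Bochner_Integration.integral_sum)
  also have "\<dots> \<le> (\<Sum>i\<in>I. \<Sum>j\<in>I. (if i = j then 1 else 0) + \<epsilon>\<^sup>2 / 4)"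
  proof (intro sum_mono)
    fix i j assume ij: "i \<in> I" "j \<in> I"
    let ?e = "\<integral>x. g i x * g j x \<partial>M"
    have "(\<sigma> i * \<sigma> j) * ?e \<le> \<bar>\<sigma> i\<bar> * \<bar>\<sigma> j\<bar> * \<bar>?e\<bar>" by (metis abs_ge_self abs_mult)
    also have "\<dots> \<le> 1 * 1 * \<bar>?e\<bar>" using \<sigma> by (intro mult_mono) auto
    also have "\<bar>?e\<bar> \<le> (if i = j then 1 else 0) + \<epsilon>\<^sup>2 / 4"
    proof (cases "i = j")
      case True
      have "\<bar>?e\<bar> \<le> (\<integral>x. \<bar>g i x * g j x\<bar> \<partial>M)" by (rule integral_abs_bound)
      also have "\<dots> \<le> (\<integral>x. 1 \<partial>M)"
        using gb by (intro integral_mono integrable_abs int_gg[OF ij])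
           (auto simp: abs_mult intro!: mult_le_one)
      finally have "\<bar>?e\<bar> \<le> 1" by (simp add: prob_space)
      then show ?thesis using True by (simp add: add_increasing2)
    next
      case False
      have *: "c * \<bar>prob (B k) - c\<bar> \<le> \<epsilon>\<^sup>2 / 12" if "k \<in> I" for k
        using mult_mono[OF c(2) B1[OF that]] c by simp
      have abs_triangle3: "\<bar>p - q - r\<bar> \<le> \<bar>p\<bar> + \<bar>q\<bar> + \<bar>r\<bar>" for p q r :: real by linarith
      have "?e = (prob (B i \<inter> B j) - c\<^sup>2) - c * (prob (B i) - c) - c * (prob (B j) - c)"
        unfolding gg[OF ij] by (simp add: algebra_simps power2_eq_square)
      then have "\<bar>?e\<bar> \<le> \<bar>prob (B i \<inter> B j) - c\<^sup>2\<bar> + c * \<bar>prob (B i) - c\<bar> + c * \<bar>prob (B j) - c\<bar>"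
        using abs_triangle3[of "prob (B i \<inter> B j) - c\<^sup>2" "c * (prob (B i) - c)" "c * (prob (B j) - c)"] c
        by (simp add: abs_mult)
      then show ?thesis using B2[OF ij False] *[OF ij(1)] *[OF ij(2)] False by simp
    qed
    finally show "(\<sigma> i * \<sigma> j) * ?e \<le> (if i = j then 1 else 0) + \<epsilon>\<^sup>2 / 4" by simp
  qed
  also have "\<dots> = N + N * N * (\<epsilon>\<^sup>2 / 4)"
    using assms(1) by (simp add: sum.distrib N_def algebra_simps)
  finally have upper: "(\<integral>x. H x * H x \<partial>M) \<le> N + N * N * (\<epsilon>\<^sup>2 / 4)" .
  have AH: "indicator A x * H x = (\<Sum>i\<in>I. \<sigma> i * (indicator A x * g i x))" for x
    unfolding H_def sum_distrib_left by (intro sum.cong) auto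
  have int_AH: "integrable M (\<lambda>x. indicator A x * H x)"
    unfolding AH using int_Ag by (intro Bochner_Integration.integrable_sum integrable_mult_right) auto
  have "(\<integral>x. indicator A x * H x \<partial>M) = (\<Sum>i\<in>I. \<bar>prob (A \<inter> B i) - c * prob A\<bar>)"
    unfolding AH using int_Ag Ag by (simp add: Bochner_Integration.integral_sum \<sigma>_def abs_sgn mult.commute)
  moreover have "\<dots> \<ge> (\<Sum>i\<in>I. \<epsilon>)" using far by (intro sum_mono)
  ultimately have lower: "N * \<epsilon> \<le> (\<integral>x. indicator A x * H x \<partial>M)" by (simp add: N_def)
  \<comment> \<open>Cauchy--Schwarz against the indicator of \<open>A\<close>, in the form \<open>2 t h \<le> t\<^sup>2 + h\<^sup>2\<close>
    with \<open>t = N \<epsilon>\<close>.\<close>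
  have "2 * (N * \<epsilon>) * (\<integral>x. indicator A x * H x \<partial>M) \<le> (\<integral>x. (N * \<epsilon>)\<^sup>2 + H x * H x \<partial>M)"
  proof -
    have "(\<integral>x. 2 * (N * \<epsilon>) * (indicator A x * H x) \<partial>M) \<le> (\<integral>x. (N * \<epsilon>)\<^sup>2 + H x * H x \<partial>M)"
    proof (intro integral_mono)
      show "2 * (N * \<epsilon>) * (indicator A x * H x) \<le> (N * \<epsilon>)\<^sup>2 + H x * H x" for x
      proof (cases "x \<in> A")
        case True
        then show ?thesis using sum_squares_ge_zero[of "N * \<epsilon> - H x" 0]
          by (simp add: algebra_simps power2_eq_square)
      qed (simp add: power2_eq_square)
    qed (use int_AH int_HH in auto)
    then show ?thesis using int_AH by simp
  qed
  also have "\<dots> = (N * \<epsilon>)\<^sup>2 + (\<integral>x. H x * H x \<partial>M)" using int_HH by (simp add: prob_space)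
  finally have "2 * (N * \<epsilon>) * (\<integral>x. indicator A x * H x \<partial>M) \<le> (N * \<epsilon>)\<^sup>2 + (\<integral>x. H x * H x \<partial>M)" .
  moreover have "2 * (N * \<epsilon>) * (N * \<epsilon>) \<le> 2 * (N * \<epsilon>) * (\<integral>x. indicator A x * H x \<partial>M)"
    using lower N assms(3) by (intro mult_left_mono) auto
  ultimately have "2 * (N * \<epsilon>) * (N * \<epsilon>) \<le> (N * \<epsilon>)\<^sup>2 + (N + N * N * (\<epsilon>\<^sup>2 / 4))"
    using upper by linarith
  then have "N * (N * \<epsilon>\<^sup>2) * (3 / 4) \<le> N * 1" by (simp add: power2_eq_square algebra_simps)
  then have "N * \<epsilon>\<^sup>2 * (3 / 4) \<le> 1" using N by simp
  then show False using card by (simp add: N_def mult.commute)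
qed

section \<open>The action of the integers on measurable sets\<close>

context invertible_mps
begin

abbreviation iter :: "int \<Rightarrow> 'a \<Rightarrow> 'a" where
  "iter \<equiv> int_iter (space M) T"

definition shift :: "int \<Rightarrow> 'a set \<Rightarrow> 'a set" where
  "shift n A = iter n ` A"

lemma T_space [simp]: "x \<in> space M \<Longrightarrow> T x \<in> space M"
  using T_bij by (auto simp: bij_betw_def)

lemma inv_T_space [simp]: "x \<in> space M \<Longrightarrow> inv_into (space M) T x \<in> space M"
  using T_bij by (metis bij_betw_imp_surj_on inv_into_into)

lemma T_inv_T [simp]: "x \<in> space M \<Longrightarrow> T (inv_into (space M) T x) = x"
  using T_bij by (metis bij_betw_imp_surj_on f_inv_into_f)

lemma iter_0 [simp]: "iter 0 x = x"
  by (simp add: int_iter_def)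

lemma iter_space [simp]: "x \<in> space M \<Longrightarrow> iter n x \<in> space M"
proof -
  assume x: "x \<in> space M"
  have "(T ^^ k) x \<in> space M" "(inv_into (space M) T ^^ k) x \<in> space M" for k
    using x by (induction k) auto
  then show ?thesis by (simp add: int_iter_def)
qed

lemma iter_Suc: "x \<in> space M \<Longrightarrow> iter (n + 1) x = T (iter n x)"
proof (cases "0 \<le> n")
  case True
  then show ?thesis by (simp add: int_iter_def nat_add_distrib)
next
  case False
  assume x: "x \<in> space M"
  define k where "k = nat (- (n + 1))"
  have n: "n = - int k - 1" and k: "nat (- n) = Suc k" using False by (auto simp: k_def)
  have "(inv_into (space M) T ^^ k) x \<in> space M"
    using x by (induction k) auto
  moreover have "iter (n + 1) x = (inv_into (space M) T ^^ k) x"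
    using n by (cases "k = 0") (auto simp: int_iter_def)
  ultimately show ?thesis using False k by (simp add: int_iter_def)
qed

lemma iter_add: "x \<in> space M \<Longrightarrow> iter (m + n) x = iter m (iter n x)"
proof (induction m rule: int_induct[where k = 0])
  case (step1 i)
  then show ?case using iter_Suc[of x "i + n"] iter_Suc[of "iter n x" i] by (simp add: ac_simps)
next
  case (step2 i)
  have "T (iter (i - 1 + n) x) = T (iter (i - 1) (iter n x))"
    using step2 iter_Suc[of x "i - 1 + n"] iter_Suc[of "iter n x" "i - 1"]
    by (simp add: algebra_simps)
  then show ?case
    using T_bij step2.prems by (meson bij_betw_imp_inj_on inj_onD iter_space)
qed simp

lemma inj_on_iter: "inj_on (iter n) (space M)"
proof (rule inj_on_inverseI[where g = "iter (- n)"])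
  show "iter (- n) (iter n x) = x" if "x \<in> space M" for x
    using iter_add[OF that, of "- n" n] by simp
qed

lemma shift_0 [simp]: "shift 0 A = A"
  by (simp add: shift_def)

lemma shift_add: "A \<subseteq> space M \<Longrightarrow> shift (m + n) A = shift m (shift n A)"
  using iter_add by (force simp: shift_def image_image intro!: image_cong)

lemma shift_subset: "A \<subseteq> space M \<Longrightarrow> shift n A \<subseteq> space M"
  by (auto simp: shift_def)

lemma shift_space [simp]: "shift n (space M) = space M"
proof
  have "shift n (shift (- n) (space M)) \<subseteq> shift n (space M)"
    using shift_subset[of "space M" "- n"] by (auto simp: shift_def)
  then show "space M \<subseteq> shift n (space M)"
    using shift_add[of "space M" n "- n"] by simp
qed (simp add: shift_subset)

lemma shift_Int:
  "A \<subseteq> space M \<Longrightarrow> B \<subseteq> space M \<Longrightarrow> shift n (A \<inter> B) = shift n A \<inter> shift n B"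
  unfolding shift_def by (rule inj_on_image_Int[OF inj_on_iter])

lemma shift_INT:
  assumes "J \<noteq> {}" "\<And>j. j \<in> J \<Longrightarrow> A j \<subseteq> space M"
  shows "shift n (\<Inter>j\<in>J. A j) = (\<Inter>j\<in>J. shift n (A j))"
proof -
  obtain j where "j \<in> J" using assms(1) by blast
  then show ?thesis
    unfolding shift_def using assms(2) by (intro image_INT[OF inj_on_iter]) auto
qed

lemma shift_one_measurable:
  assumes "A \<in> events"
  shows "shift 1 A \<in> events" "prob (shift 1 A) = prob A" "shift (- 1) A \<in> events"
proof -
  have A: "A \<subseteq> space M" using assms sets.sets_into_space by blast
  have T: "iter 1 x = T x" for x by (simp add: int_iter_def)
  have inv: "iter (- 1) x = inv_into (space M) T x" for x by (simp add: int_iter_def)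
  have "shift 1 A = inv_into (space M) T -` A \<inter> space M"
    unfolding shift_def T
  proof (intro set_eqI iffI)
    show "x \<in> inv_into (space M) T -` A \<inter> space M" if "x \<in> T ` A" for x
      using that A T_bij by (auto simp: bij_betw_def subset_iff)
    show "x \<in> T ` A" if "x \<in> inv_into (space M) T -` A \<inter> space M" for x
      using that by (auto intro: rev_image_eqI)
  qed
  then show 1: "shift 1 A \<in> events" using T_inv_measurable assms by (simp add: measurable_sets)
  have "shift (- 1) A = T -` A \<inter> space M"
    unfolding shift_def inv
  proof (intro set_eqI iffI)
    show "x \<in> T -` A \<inter> space M" if "x \<in> inv_into (space M) T ` A" for x
      using that A by (auto simp: subset_iff)
    show "x \<in> inv_into (space M) T ` A" if "x \<in> T -` A \<inter> space M" for x
      using that T_bij by (auto simp: bij_betw_def intro: rev_image_eqI)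
  qed
  then show "shift (- 1) A \<in> events" using T_measurable assms by (simp add: measurable_sets)
  have "prob (shift 1 A) = measure (distr M M T) (shift 1 A)" by (simp add: T_preserves)
  also have "\<dots> = prob (T -` shift 1 A \<inter> space M)"
    using 1 T_measurable by (rule measure_distr[rotated])
  also have "T -` shift 1 A \<inter> space M = A"
    using T_bij A unfolding shift_def T bij_betw_def by (auto simp: inj_on_def)
  finally show "prob (shift 1 A) = prob A" .
qed

lemma shift_measurable [measurable]: "A \<in> events \<Longrightarrow> shift n A \<in> events"
proof (induction n rule: int_induct[where k = 0])
  case (step1 i)
  then show ?case
    using shift_add[of A 1 i] shift_one_measurable(1) sets.sets_into_space[OF step1.prems]
    by (simp add: add.commute)
next
  case (step2 i)
  then show ?case
    using shift_add[of A "- 1" i] shift_one_measurable(3) sets.sets_into_space[OF step2.prems]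
    by simp
qed simp

lemma prob_shift [simp]: "A \<in> events \<Longrightarrow> prob (shift n A) = prob A"
proof (induction n rule: int_induct[where k = 0])
  case (step1 i)
  then show ?case
    using shift_add[of A 1 i] shift_one_measurable(2)[of "shift i A"] sets.sets_into_space[OF step1.prems]
    by (simp add: add.commute shift_measurable)
next
  case (step2 i)
  then show ?case
    using shift_add[of A 1 "i - 1"] shift_one_measurable(2)[of "shift (i - 1) A"]
      sets.sets_into_space[OF step2.prems] by (simp add: shift_measurable)
qed simp

lemma prob_shift_Int:
  assumes "A \<in> events" "B \<in> events"
  shows "prob (shift a A \<inter> shift b B) = prob (A \<inter> shift (b - a) B)"
proof -
  have "A \<subseteq> space M" "B \<subseteq> space M" using assms sets.sets_into_space by blast+
  then have "shift a A \<inter> shift b B = shift a (A \<inter> shift (b - a) B)"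
    using shift_add[of B a "b - a"] by (simp add: shift_Int shift_subset)
  then show ?thesis using assms by (simp add: shift_measurable)
qed

section \<open>Strong mixing implies mixing along increasing sums\<close>

lemma strongly_mixing_tendsto:
  assumes "strongly_mixing M T" "A \<in> events" "B \<in> events" "abs_to_infinity u"
  shows "(\<lambda>k. prob (A \<inter> shift (u k) B)) \<longlonglongrightarrow> prob A * prob B"
proof -
  have "((\<lambda>n. prob (A \<inter> shift n B)) \<longlongrightarrow> prob A * prob B) (filtercomap abs at_top)"
    using assms(1-3) by (simp add: strongly_mixing_def shift_def)
  moreover have "filterlim u (filtercomap abs at_top) sequentially"
    using assms(4) by (simp add: abs_to_infinity_def filterlim_filtercomap_iff comp_def)
  ultimately show ?thesis by (rule filterlim_compose)
qed

lemma abs_to_infinity_diff_const: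
  assumes "abs_to_infinity u"
  shows "abs_to_infinity (\<lambda>k. u k - c)"
  unfolding abs_to_infinity_def filterlim_at_top
proof
  fix b
  have "eventually (\<lambda>k. b + \<bar>c\<bar> \<le> \<bar>u k\<bar>) sequentially"
    using assms by (simp add: abs_to_infinity_def filterlim_at_top)
  then show "eventually (\<lambda>k. b \<le> \<bar>u k - c\<bar>) sequentially"
    by (rule eventually_mono) linarith
qed

text \<open>
  The index set \<open>J\<close> is treated symmetrically: the stationary set \<open>A 0\<close> is simply the
  coordinate whose sequences vanish. The induction fixes one coordinate \<open>t0\<close> and spends the first
  summand on the remaining ones. For two candidates \<open>a\<close>, \<open>b\<close> for the first index, with the same
  later indices, the intersection of the corresponding events is again a multiple intersection, of
  the sets \<open>A t \<inter> T\<^sup>d A t\<close> up to a shift; mixing makes these nearly of measure \<open>(prob (A t))\<^sup>2\<close>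
  when \<open>a\<close> and \<open>b\<close> are far apart, and the induction hypothesis then chooses later indices that
  serve all pairs of candidates. So the candidate events are nearly pairwise independent, and one of
  them is nearly independent of the set with index \<open>t0\<close>.
\<close>

lemma mixing_along_increasing_sums:
  assumes mix: "strongly_mixing M T"
    and "finite J" "card J = Suc m" "\<And>t. t \<in> J \<Longrightarrow> A t \<in> events"
    and "\<And>i t t'. i < m \<Longrightarrow> t \<in> J \<Longrightarrow> t' \<in> J \<Longrightarrow> t \<noteq> t' \<Longrightarrow>
           abs_to_infinity (\<lambda>k. s i k t - s i k t')"
    and "infinite Z" "0 < \<epsilon>"
  shows "\<exists>ks\<in>increasing_tuples Z m.
    \<bar>prob (\<Inter>t\<in>J. shift (selected_sum (\<lambda>i k. s i k t) ks) (A t)) - (\<Prod>t\<in>J. prob (A t))\<bar> < \<epsilon>"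
  using assms(2-)
proof (induction m arbitrary: J A s Z \<epsilon>)
  case 0
  then obtain t where "J = {t}" using card_1_singletonE by (metis One_nat_def)
  then show ?case using 0 by (intro bexI[of _ "[]"]) (auto simp: increasing_tuples_def)
next
  case (Suc m)
  note A = Suc.prems(3)
  obtain t0 where t0: "t0 \<in> J" using Suc.prems(2) by (metis card_eq_0_iff ex_in_conv nat.distinct(1))
  define J' where "J' = J - {t0}"
  have J': "finite J'" "card J' = Suc m" "J' \<noteq> {}" "J = insert t0 J'" "t0 \<notin> J'"
  proof -
    show "finite J'" "card J' = Suc m" "J = insert t0 J'" "t0 \<notin> J'"
      using Suc.prems(1,2) t0 by (auto simp: J'_def)
    then show "J' \<noteq> {}" by auto
  qed
  have AJ': "A t \<in> events" if "t \<in> J'" for t using A that J' by blast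
  define c where "c = (\<Prod>t\<in>J'. prob (A t))"
  have c: "0 \<le> c" "c \<le> 1" by (auto simp: c_def intro!: prod_nonneg prod_le_1)
  \<comment> \<open>Half of the tolerance in the second moment argument: one half is spent on mixing, the other
    on the induction hypothesis.\<close>
  define \<delta> where "\<delta> = \<epsilon>\<^sup>2 / 24"
  have \<delta>: "0 < \<delta>" using Suc.prems(6) by (simp add: \<delta>_def)
  obtain N :: nat where N: "4 / \<epsilon>\<^sup>2 < real N" using reals_Archimedean2 by blast
  have "0 < 4 / \<epsilon>\<^sup>2" using Suc.prems(6) by simp
  then have "0 < N" using N by linarith
  define d where "d a t = s 0 a t - s 0 a t0" for a t
  define C where "C a b t = shift (d a t) (A t) \<inter> shift (d b t) (A t)" for a b t
  have C: "C a b t \<in> events" if "t \<in> J'" for a b t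
    using AJ'[OF that] by (auto simp: C_def intro!: shift_measurable)
  have prob_C: "prob (C a b t) = prob (A t \<inter> shift (d b t - d a t) (A t))" if "t \<in> J'" for a b t
    unfolding C_def using AJ'[OF that] by (rule prob_shift_Int[OF _ AJ'[OF that]])
  have ev: "eventually (\<lambda>b. \<bar>(\<Prod>t\<in>J'. prob (C a b t)) - c\<^sup>2\<bar> < \<delta>) sequentially" for a
  proof -
    have "(\<lambda>b. prob (C a b t)) \<longlonglongrightarrow> prob (A t) * prob (A t)" if t: "t \<in> J'" for t
    proof -
      have "abs_to_infinity (\<lambda>b. d b t - d a t)"
        unfolding d_def using t J' t0 by (intro abs_to_infinity_diff_const Suc.prems(4)) auto
      then show ?thesis
        unfolding prob_C[OF t] using AJ'[OF t] by (intro strongly_mixing_tendsto[OF mix])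
    qed
    then have "(\<lambda>b. \<Prod>t\<in>J'. prob (C a b t)) \<longlonglongrightarrow> (\<Prod>t\<in>J'. prob (A t) * prob (A t))"
      by (intro tendsto_prod)
    then have "(\<lambda>b. \<Prod>t\<in>J'. prob (C a b t)) \<longlonglongrightarrow> c\<^sup>2"
      by (simp add: c_def prod.distrib power2_eq_square)
    from tendstoD[OF this \<delta>] show ?thesis by (simp add: dist_real_def)
  qed
  obtain K where K: "K \<subseteq> Z" "finite K" "card K = N"
    and K_lt: "\<forall>a\<in>K. \<forall>b\<in>K. a < b \<longrightarrow> \<bar>(\<Prod>t\<in>J'. prob (C a b t)) - c\<^sup>2\<bar> < \<delta>"
    using pairwise_related_subset[where R = "\<lambda>a b. \<bar>(\<Prod>t\<in>J'. prob (C a b t)) - c\<^sup>2\<bar> < \<delta>"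
        and N = N, OF Suc.prems(5) ev] by (elim exE conjE)
  have C_commute: "C a b = C b a" for a b by (auto simp: C_def)
  have K_neq: "\<bar>(\<Prod>t\<in>J'. prob (C a b t)) - c\<^sup>2\<bar> < \<delta>" if "a \<in> K" "b \<in> K" "a \<noteq> b" for a b
    using K_lt that C_commute[of a b] by (metis linorder_neqE_nat)
  have K_eq: "(\<Prod>t\<in>J'. prob (C a a t)) = c" for a
    unfolding c_def using AJ' by (intro prod.cong) (simp_all add: C_def)
  \<comment> \<open>The later indices have to exceed every candidate for the first one.\<close>
  define Z' where "Z' = Z - {..Max K}"
  have Z': "infinite Z'" using Suc.prems(5) by (simp add: Z'_def Diff_infinite_finite)
  define tail where "tail t ks = selected_sum (\<lambda>i k. s (Suc i) k t) ks" for t ks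
  have "\<exists>ks\<in>increasing_tuples Z' m. \<forall>(a, b)\<in>K \<times> K.
      \<bar>prob (\<Inter>t\<in>J'. shift (tail t ks) (C a b t)) - (\<Prod>t\<in>J'. prob (C a b t))\<bar> < \<delta>"
  proof (rule common_increasing_tuple)
    fix p :: "nat \<times> nat" and Y :: "nat set"
    assume "infinite Y"
    obtain a b where p: "p = (a, b)" by fastforce
    show "\<exists>ks\<in>increasing_tuples Y m. case p of (a, b) \<Rightarrow>
        \<bar>prob (\<Inter>t\<in>J'. shift (tail t ks) (C a b t)) - (\<Prod>t\<in>J'. prob (C a b t))\<bar> < \<delta>"
      unfolding p prod.case tail_def
      using J' C \<open>infinite Y\<close> \<delta> Suc.prems(4) by (intro Suc.IH) auto
  qed (use K Z' in auto)
  then obtain ks where ks: "ks \<in> increasing_tuples Z' m"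
    and tail: "\<And>a b. a \<in> K \<Longrightarrow> b \<in> K \<Longrightarrow>
      \<bar>prob (\<Inter>t\<in>J'. shift (tail t ks) (C a b t)) - (\<Prod>t\<in>J'. prob (C a b t))\<bar> < \<delta>"
    by blast
  define B where "B a = (\<Inter>t\<in>J'. shift (tail t ks) (shift (d a t) (A t)))" for a
  have sub: "shift n (A t) \<subseteq> space M" if "t \<in> J" for n t
    using shift_subset[OF sets.sets_into_space[OF A[OF that]]] .
  have B: "B a \<in> events" for a
    unfolding B_def using J' AJ' by (intro sets.finite_INT) (auto intro!: shift_measurable)
  have BB: "B a \<inter> B b = (\<Inter>t\<in>J'. shift (tail t ks) (C a b t))" for a b
    using sub J' by (auto simp: B_def C_def shift_Int)
  have "\<exists>a\<in>K. \<bar>prob (shift (tail t0 ks) (A t0) \<inter> B a) - c * prob (shift (tail t0 ks) (A t0))\<bar> < \<epsilon>"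
  proof (rule almost_independent_of_some_event)
    show "4 < \<epsilon>\<^sup>2 * card K" using N K Suc.prems(6) by (simp add: field_simps)
    show "\<bar>prob (B a) - c\<bar> \<le> \<epsilon>\<^sup>2 / 12" if "a \<in> K" for a
    proof -
      have "prob (B a) = prob (\<Inter>t\<in>J'. shift (tail t ks) (C a a t))" using BB[of a a] by simp
      then show ?thesis using tail[OF that that] \<delta> unfolding K_eq \<delta>_def by linarith
    qed
    show "\<bar>prob (B a \<inter> B b) - c\<^sup>2\<bar> \<le> \<epsilon>\<^sup>2 / 12" if "a \<in> K" "b \<in> K" "a \<noteq> b" for a b
      using tail[OF that(1,2)] K_neq[OF that] unfolding BB \<delta>_def by linarith
    show "K \<noteq> {}" using K \<open>0 < N\<close> by auto
  qed (use K Suc.prems(6) c A t0 B in \<open>auto intro!: shift_measurable\<close>)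
  then obtain a where a: "a \<in> K"
    and good: "\<bar>prob (shift (tail t0 ks) (A t0) \<inter> B a) - c * prob (A t0)\<bar> < \<epsilon>"
    using A[OF t0] by auto
  have tuple: "a # ks \<in> increasing_tuples Z (Suc m)"
  proof -
    have "a \<le> Max K" using a K by simp
    moreover have "set ks \<subseteq> Z \<inter> {Max K<..}"
      using ks by (auto simp: increasing_tuples_def Z'_def)
    ultimately have "\<forall>k\<in>set ks. a < k" by auto
    then show ?thesis using ks a K by (auto simp: increasing_tuples_def Z'_def)
  qed
  have sets_J: "shift n (A t) \<in> events" if "t \<in> J" for n t using A[OF that] by (rule shift_measurable)
  \<comment> \<open>Undo the normalisation that made the coordinate \<open>t0\<close> of the first summand zero.\<close>
  have "shift (selected_sum (\<lambda>i k. s i k t) (a # ks)) (A t)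
      = shift (s 0 a t0) (shift (tail t ks) (shift (d a t) (A t)))" if "t \<in> J" for t
  proof -
    have "A t \<subseteq> space M" using A[OF that] sets.sets_into_space by blast
    moreover have "selected_sum (\<lambda>i k. s i k t) (a # ks) = s 0 a t0 + (tail t ks + d a t)"
      by (simp add: tail_def d_def)
    ultimately show ?thesis by (simp only: shift_add shift_subset)
  qed
  then have "(\<Inter>t\<in>J. shift (selected_sum (\<lambda>i k. s i k t) (a # ks)) (A t))
      = (\<Inter>t\<in>J. shift (s 0 a t0) (shift (tail t ks) (shift (d a t) (A t))))" by simp
  also have "\<dots> = shift (s 0 a t0) (\<Inter>t\<in>J. shift (tail t ks) (shift (d a t) (A t)))"
    using t0 sets.sets_into_space[OF A] by (intro shift_INT[symmetric] shift_subset) auto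
  also have "(\<Inter>t\<in>J. shift (tail t ks) (shift (d a t) (A t))) = shift (tail t0 ks) (A t0) \<inter> B a"
    by (simp add: J'(4) B_def) (simp add: d_def)
  finally have "prob (\<Inter>t\<in>J. shift (selected_sum (\<lambda>i k. s i k t) (a # ks)) (A t))
      = prob (shift (tail t0 ks) (A t0) \<inter> B a)"
    using B sets_J[OF t0] by simp
  moreover have "(\<Prod>t\<in>J. prob (A t)) = c * prob (A t0)"
    using J' by (simp add: c_def)
  ultimately show ?case using good tuple by (intro bexI[of _ "a # ks"]) auto
qed

section \<open>Mixing along increasing sums implies strong mixing\<close>

text \<open>
  If \<open>A\<close> is correlated with all the sets \<open>T\<^sup>n B\<close>, where \<open>n\<close> runs over the sums along increasing
  \<open>m\<close>-tuples, then these sets cannot be almost pairwise independent, so \<open>B\<close> is correlated with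
  \<open>T\<^sup>n B\<close> for some difference \<open>n\<close> of two sums over successive blocks of indices. Ramsey's theorem
  makes this happen for all \<open>2 m\<close>-tuples from an infinite set. Replacing \<open>A\<close> by \<open>B\<close>, the step
  can be repeated.
\<close>

lemma correlated_differences:
  assumes "A \<in> events" and B: "B \<in> events" and "0 < \<epsilon>" "infinite Z"
    and u: "\<And>i. i < m \<Longrightarrow> abs_to_infinity (u i)"
    and bad: "\<And>ks. ks \<in> increasing_tuples Z m \<Longrightarrow>
      \<epsilon> \<le> \<bar>prob (A \<inter> shift (selected_sum u ks) B) - prob A * prob B\<bar>"
  shows "\<exists>Y v \<delta>. infinite Y \<and> 0 < \<delta> \<and> (\<forall>i<2*m. abs_to_infinity (v i)) \<and>
    (\<forall>ks\<in>increasing_tuples Y (2*m).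
      \<delta> \<le> \<bar>prob (B \<inter> shift (selected_sum v ks) B) - prob B * prob B\<bar>)"
proof -
  \<comment> \<open>The sums for \<open>v\<close> are the differences of two sums for \<open>u\<close>: the second half of the indices
    minus the first half.\<close>
  define v where "v i k = (if i < m then - u i k else u (i - m) k)" for i k
  define \<delta> where "\<delta> = \<epsilon>\<^sup>2 / 12"
  have \<delta>: "0 < \<delta>" using assms(3) by (simp add: \<delta>_def)
  have v: "abs_to_infinity (v i)" if "i < 2 * m" for i
    using u[of i] u[of "i - m"] that by (cases "i < m") (auto simp: v_def abs_to_infinity_def)
  have v_sum: "selected_sum v (xs @ ys) = selected_sum u ys - selected_sum u xs"
    if "length xs = m" "length ys = m" for xs ys
  proof -
    have "selected_sum v xs = - selected_sum u xs"
      using that by (simp add: selected_sum_def v_def sum_negf)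
    moreover have "selected_sum (\<lambda>i. v (length xs + i)) ys = selected_sum u ys"
      using that by (simp add: selected_sum_def v_def)
    ultimately show ?thesis by (simp add: selected_sum_append)
  qed
  show ?thesis
  proof (rule Ramsey_increasing_tuples[OF assms(4), of "2 * m"
        "\<lambda>ks. \<delta> \<le> \<bar>prob (B \<inter> shift (selected_sum v ks) B) - prob B * prob B\<bar>"])
    fix Y assume "infinite Y" "\<forall>ks\<in>increasing_tuples Y (2 * m).
      \<delta> \<le> \<bar>prob (B \<inter> shift (selected_sum v ks) B) - prob B * prob B\<bar>"
    then show ?thesis using \<delta> v by blast
  next
    fix Y assume Y: "Y \<subseteq> Z" "infinite Y"
      and small: "\<forall>ks\<in>increasing_tuples Y (2 * m).
        \<not> \<delta> \<le> \<bar>prob (B \<inter> shift (selected_sum v ks) B) - prob B * prob B\<bar>"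
    define block where "block i = map (enumerate Y) [i * m..<Suc i * m]" for i
    have block: "block i \<in> increasing_tuples Y m" for i
    proof -
      have "sorted_wrt (<) (block i)"
        unfolding sorted_wrt_iff_nth_less using Y(2) by (auto simp: block_def)
      moreover have "set (block i) \<subseteq> Y" using Y(2) by (auto simp: block_def enumerate_in_set)
      ultimately show ?thesis by (simp add: increasing_tuples_def) (simp add: block_def)
    qed
    have blocks: "block i @ block j \<in> increasing_tuples Y (2 * m)" if "i < j" for i j
    proof -
      have "p < q" if "p \<in> set (block i)" "q \<in> set (block j)" for p q
      proof -
        obtain x where x: "p = enumerate Y x" "x < Suc i * m"
          using \<open>p \<in> set (block i)\<close> unfolding block_def by auto
        obtain y where y: "q = enumerate Y y" "j * m \<le> y"
          using \<open>q \<in> set (block j)\<close> unfolding block_def by auto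
        have "Suc i * m \<le> j * m" using \<open>i < j\<close> by (intro mult_le_mono1) simp
        then have "x < y" using x(2) y(2) by linarith
        then show ?thesis unfolding x(1) y(1) using Y(2) by simp
      qed
      then show ?thesis
        using block[of i] block[of j]
        by (auto simp: increasing_tuples_def sorted_wrt_append)
    qed
    define E where "E i = shift (selected_sum u (block i)) B" for i
    have E_less: "\<bar>prob (E i \<inter> E j) - (prob B)\<^sup>2\<bar> \<le> \<delta>" if "i < j" for i j
    proof -
      have "prob (E i \<inter> E j) = prob (B \<inter> shift (selected_sum v (block i @ block j)) B)"
        unfolding E_def prob_shift_Int[OF B B] using v_sum[of "block i" "block j"]
        by (simp add: block_def)
      then show ?thesis using small blocks[OF that] by (auto simp: power2_eq_square)
    qed
    have EE: "\<bar>prob (E i \<inter> E j) - (prob B)\<^sup>2\<bar> \<le> \<delta>" if "i \<noteq> j" for i j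
      using E_less that by (metis Int_commute linorder_neqE_nat)
    obtain N :: nat where N: "4 / \<epsilon>\<^sup>2 < real N" using reals_Archimedean2 by blast
    have "0 < 4 / \<epsilon>\<^sup>2" using assms(3) by simp
    then have "0 < N" using N by linarith
    have "\<exists>i\<in>{..<N}. \<bar>prob (A \<inter> E i) - prob B * prob A\<bar> < \<epsilon>"
      by (rule almost_independent_of_some_event)
         (use \<open>0 < N\<close> N assms(1-3) EE in
           \<open>auto simp: E_def \<delta>_def field_simps lessThan_empty_iff intro!: shift_measurable\<close>)
    then obtain i where "\<bar>prob (A \<inter> E i) - prob B * prob A\<bar> < \<epsilon>" by blast
    moreover have "block i \<in> increasing_tuples Z m"
      using block increasing_tuples_mono[OF Y(1)] by blast
    ultimately have False using bad[of "block i"] by (simp add: E_def mult.commute)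
    then show ?thesis ..
  qed
qed

text \<open>
  A sequence without the mixing property thus yields correlations along sums of \<open>2\<^sup>r\<close> terms for every
  \<open>r\<close>; fixing the first few terms leaves exactly \<open>l\<close> terms.
\<close>

lemma correlated_increasing_sums:
  assumes "\<not> strongly_mixing M T" and "1 \<le> l"
  obtains A B Z u \<epsilon> where "A \<in> events" "B \<in> events" "infinite Z" "0 < \<epsilon>"
    "\<And>i. i < l \<Longrightarrow> abs_to_infinity (u i)"
    "\<And>ks. ks \<in> increasing_tuples Z l \<Longrightarrow>
      \<epsilon> \<le> \<bar>prob (A \<inter> shift (selected_sum u ks) B) - prob A * prob B\<bar>"
proof -
  obtain A0 A1 where A01: "A0 \<in> events" "A1 \<in> events"
    and nlim: "\<not> ((\<lambda>n. prob (A0 \<inter> shift n A1)) \<longlongrightarrow> prob A0 * prob A1) (filtercomap abs at_top)"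
    using assms(1) unfolding strongly_mixing_def shift_def by blast
  then obtain e where e: "0 < e"
    and freq: "\<not> eventually (\<lambda>n. dist (prob (A0 \<inter> shift n A1)) (prob A0 * prob A1) < e)
      (filtercomap abs at_top)"
    unfolding tendsto_iff by blast
  have "\<exists>n. N \<le> \<bar>n\<bar> \<and> e \<le> \<bar>prob (A0 \<inter> shift n A1) - prob A0 * prob A1\<bar>" for N :: int
  proof (rule ccontr)
    assume "\<not> ?thesis"
    then have "\<bar>prob (A0 \<inter> shift n A1) - prob A0 * prob A1\<bar> < e" if "N \<le> \<bar>n\<bar>" for n
      using that linorder_not_less by blast
    moreover have "eventually (\<lambda>n. N \<le> \<bar>n\<bar>) (filtercomap abs at_top)"
      by (rule eventually_filtercomapI[OF eventually_ge_at_top])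
    ultimately have "eventually (\<lambda>n. \<bar>prob (A0 \<inter> shift n A1) - prob A0 * prob A1\<bar> < e)
        (filtercomap abs at_top)"
      by (rule eventually_mono[rotated])
    then show False using freq by (simp add: dist_real_def)
  qed
  then have "\<forall>k. \<exists>n. int k \<le> \<bar>n\<bar> \<and> e \<le> \<bar>prob (A0 \<inter> shift n A1) - prob A0 * prob A1\<bar>" by blast
  from choice[OF this] obtain w where w: "\<And>k. int k \<le> \<bar>w k\<bar>"
      "\<And>k. e \<le> \<bar>prob (A0 \<inter> shift (w k) A1) - prob A0 * prob A1\<bar>"
    by blast
  have w_lim: "abs_to_infinity w"
    unfolding abs_to_infinity_def
    by (rule filterlim_at_top_mono[OF filterlim_int_sequentially]) (simp add: w)
  have "\<exists>A\<in>events. \<exists>Z u \<epsilon>. infinite Z \<and> 0 < \<epsilon> \<and> (\<forall>i<2^r. abs_to_infinity (u i)) \<and>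
    (\<forall>ks\<in>increasing_tuples Z (2^r).
      \<epsilon> \<le> \<bar>prob (A \<inter> shift (selected_sum u ks) A1) - prob A * prob A1\<bar>)" for r
  proof (induction r)
    case 0
    have "e \<le> \<bar>prob (A0 \<inter> shift (selected_sum (\<lambda>_. w) ks) A1) - prob A0 * prob A1\<bar>"
      if ks: "ks \<in> increasing_tuples UNIV (2^0)" for ks
    proof -
      obtain k where "ks = [k]" using ks by (auto simp: increasing_tuples_def length_Suc_conv)
      then show ?thesis using w(2) by simp
    qed
    then show ?case
      by (intro bexI[OF _ A01(1)] exI[of _ UNIV] exI[of _ "\<lambda>_. w"] exI[of _ e])
        (simp add: e w_lim)
  next
    case (Suc r)
    then obtain A Z u \<epsilon> where A: "A \<in> events" "infinite Z" "0 < \<epsilon>"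
      and u: "\<forall>i<2^r. abs_to_infinity (u i)"
      and bad: "\<forall>ks\<in>increasing_tuples Z (2^r).
        \<epsilon> \<le> \<bar>prob (A \<inter> shift (selected_sum u ks) A1) - prob A * prob A1\<bar>"
      by (elim bexE exE conjE)
    from correlated_differences[OF A(1) A01(2) A(3,2) u[rule_format] bspec[OF bad]]
    show ?case unfolding power_Suc by (intro bexI[OF _ A01(2)])
  qed
  from this[of l] obtain A Z u \<epsilon> where A: "A \<in> events" "infinite Z" "0 < \<epsilon>"
    and u: "\<forall>i<2^l. abs_to_infinity (u i)"
    and bad: "\<forall>ks\<in>increasing_tuples Z (2^l).
        \<epsilon> \<le> \<bar>prob (A \<inter> shift (selected_sum u ks) A1) - prob A * prob A1\<bar>"
    by (elim bexE exE conjE)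
  have "l \<le> 2^l" by (simp add: less_imp_le)
  then obtain p where p: "2^l = p + l" by (metis add.commute le_Suc_ex)
  obtain xs where xs: "xs \<in> increasing_tuples Z p"
    using increasing_tuple_exists[OF A(2)] by blast
  define Y where "Y = Z - {..Max (set xs)}"
  \<comment> \<open>The fixed initial terms \<open>xs\<close> contribute a constant, which the first remaining sequence
    absorbs.\<close>
  define v where "v i k = u (p + i) k - (if i = 0 then - selected_sum u xs else 0)" for i k
  show thesis
  proof (rule that[of A A1 Y \<epsilon> v])
    show "infinite Y" using A(2) by (simp add: Y_def Diff_infinite_finite)
    show "abs_to_infinity (v i)" if "i < l" for i
      unfolding v_def using that p by (intro abs_to_infinity_diff_const u[rule_format]) simp
    fix ks assume ks: "ks \<in> increasing_tuples Y l"
    have "x < k" if "x \<in> set xs" "k \<in> set ks" for x k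
    proof -
      have "k \<in> Y" using ks that by (auto simp: increasing_tuples_def)
      moreover have "x \<le> Max (set xs)" using that by simp
      ultimately show ?thesis by (simp add: Y_def)
    qed
    then have "xs @ ks \<in> increasing_tuples Z (2^l)"
      using xs ks p by (auto simp: increasing_tuples_def sorted_wrt_append Y_def)
    moreover have "selected_sum v ks = selected_sum u (xs @ ks)"
    proof -
      obtain k ks' where "ks = k # ks'"
        using ks assms(2) by (cases ks) (auto simp: increasing_tuples_def)
      then show ?thesis
        using xs by (simp add: selected_sum_append increasing_tuples_def)
          (simp add: v_def selected_sum_def)
    qed
    ultimately show "\<epsilon> \<le> \<bar>prob (A \<inter> shift (selected_sum v ks) A1) - prob A * prob A1\<bar>"
      using bad by simp
  qed (use A A01 in auto)
qed

section \<open>Translation to the families of sets in the integer lattice\<close>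

lemma selected_sum_as_indexed_sum:
  "length ks = m \<Longrightarrow> selected_sum u ks = (\<Sum>j=1..m. u (j - 1) (ks ! (j - 1)))"
  unfolding selected_sum_def
  by (rule sum.reindex_bij_witness[of _ "\<lambda>j. j - 1" Suc]) auto

lemma strongly_mixing_imp_tilde_Sigma_star:
  assumes mix: "strongly_mixing M T" and A: "\<And>j. j \<in> {0..l} \<Longrightarrow> A j \<in> events" and "0 < \<epsilon>"
  shows "is_tilde_Sigma_star l l (return_set M T l \<epsilon> A)"
  unfolding is_tilde_Sigma_star_def
proof (intro conjI allI impI)
  show "return_set M T l \<epsilon> A \<subseteq> int_lattice l" by (auto simp: return_set_def)
  fix E assume "is_tilde_Sigma l l E"
  then obtain s where s: "\<And>j t. j \<in> {1..l} \<Longrightarrow> t \<in> {1..l} \<Longrightarrow> abs_to_infinity (\<lambda>k. s j k t)"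
    "\<And>j t t'. j \<in> {1..l} \<Longrightarrow> t \<in> {1..l} \<Longrightarrow> t' \<in> {1..l} \<Longrightarrow> t \<noteq> t' \<Longrightarrow>
      abs_to_infinity (\<lambda>k. s j k t - s j k t')"
    and E: "E = {\<lambda>t\<in>{1..l}. \<Sum>j=1..l. s j (\<kappa> j) t | \<kappa> :: nat \<Rightarrow> nat.
               (\<forall>j\<in>{1..l}. 1 \<le> \<kappa> j) \<and> strict_mono_on {1..l} \<kappa>}"
    unfolding is_tilde_Sigma_def by blast
  \<comment> \<open>The stationary set \<open>A 0\<close> becomes a coordinate with zero sequences, whose difference from
    coordinate \<open>t\<close> is coordinate \<open>t\<close> itself.\<close>
  define s0 where "s0 i k t = (if t = 0 then 0 else s (Suc i) k t)" for i k t
  have s0: "abs_to_infinity (\<lambda>k. s0 i k t - s0 i k t')"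
    if "i < l" "t \<in> {0..l}" "t' \<in> {0..l}" "t \<noteq> t'" for i t t'
    using that s(1)[of "Suc i" t] s(1)[of "Suc i" t'] s(2)[of "Suc i" t t']
    by (cases "t = 0"; cases "t' = 0") (auto simp: s0_def abs_to_infinity_def)
  have "\<exists>ks\<in>increasing_tuples {1..} l.
    \<bar>prob (\<Inter>t\<in>{0..l}. shift (selected_sum (\<lambda>i k. s0 i k t) ks) (A t))
      - (\<Prod>t\<in>{0..l}. prob (A t))\<bar> < \<epsilon>"
    by (rule mixing_along_increasing_sums[OF mix]) (use A s0 assms(3) infinite_Ici[of "1::nat"] in auto)
  then obtain ks where ks: "ks \<in> increasing_tuples {1..} l"
    and good: "\<bar>prob (\<Inter>t\<in>{0..l}. shift (selected_sum (\<lambda>i k. s0 i k t) ks) (A t))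
      - (\<Prod>t\<in>{0..l}. prob (A t))\<bar> < \<epsilon>" by blast
  have len: "length ks = l" using ks by (simp add: increasing_tuples_def)
  define \<kappa> where "\<kappa> j = ks ! (j - 1)" for j
  define n where "n = (\<lambda>t\<in>{1..l}. \<Sum>j=1..l. s j (\<kappa> j) t)"
  have "\<forall>j\<in>{1..l}. 1 \<le> \<kappa> j"
  proof
    fix j assume "j \<in> {1..l}"
    then have "\<kappa> j \<in> set ks" using len by (auto simp: \<kappa>_def)
    then show "1 \<le> \<kappa> j" using ks by (auto simp: increasing_tuples_def)
  qed
  moreover have "strict_mono_on {1..l} \<kappa>"
  proof (rule strict_mono_onI)
    fix i j assume "i \<in> {1..l}" "j \<in> {1..l}" "i < j"
    then show "\<kappa> i < \<kappa> j"
      using ks len unfolding increasing_tuples_def \<kappa>_def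
      by (intro sorted_wrt_nth_less[of "(<)" ks]) auto
  qed
  ultimately have "n \<in> E" unfolding E n_def by blast
  have "selected_sum (\<lambda>i k. s0 i k t) ks = n t" if "t \<in> {1..l}" for t
    using that by (simp add: selected_sum_as_indexed_sum[OF len] n_def \<kappa>_def s0_def)
  moreover have "selected_sum (\<lambda>i k. s0 i k 0) ks = 0"
    by (simp add: selected_sum_def s0_def)
  moreover have "{0..l} = insert 0 {1..l}" by auto
  ultimately have "(\<Inter>t\<in>{0..l}. shift (selected_sum (\<lambda>i k. s0 i k t) ks) (A t))
      = A 0 \<inter> (\<Inter>j\<in>{1..l}. iter (n j) ` A j)"
    by (simp add: shift_def)
  moreover have "n \<in> int_lattice l" by (simp add: n_def int_lattice_def)
  ultimately have "n \<in> return_set M T l \<epsilon> A" using good by (simp add: return_set_def)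
  with \<open>n \<in> E\<close> show "return_set M T l \<epsilon> A \<inter> E \<noteq> {}" by blast
qed

text \<open>
  Taking the whole space for \<open>A j\<close> with \<open>j \<ge> 2\<close> turns the return set into a condition on the first
  coordinate, which can be chosen to violate mixing. The other coordinates merely have to diverge,
  also from each other and from the first one, so multiples of a sequence that dominates the first
  coordinate will do.
\<close>

lemma tilde_Sigma_star_imp_strongly_mixing:
  assumes "1 \<le> l"
    and star: "\<And>A \<epsilon>. (\<forall>j\<in>{0..l}. A j \<in> events) \<Longrightarrow> 0 < \<epsilon> \<Longrightarrow>
      is_tilde_Sigma_star l l (return_set M T l \<epsilon> A)"
  shows "strongly_mixing M T"
proof (rule ccontr)
  assume "\<not> strongly_mixing M T"
  from correlated_increasing_sums[OF this assms(1)] obtain A0 A1 Z u \<epsilon>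
    where A01: "A0 \<in> events" "A1 \<in> events" and Z: "infinite Z" and \<epsilon>: "0 < \<epsilon>"
    and u: "\<And>i. i < l \<Longrightarrow> abs_to_infinity (u i)"
    and bad: "\<And>ks. ks \<in> increasing_tuples Z l \<Longrightarrow>
      \<epsilon> \<le> \<bar>prob (A0 \<inter> shift (selected_sum u ks) A1) - prob A0 * prob A1\<bar>" by metis
  \<comment> \<open>Every increasing choice of indices is available in the lattice set, so the infinite set \<open>Z\<close>
    of bad indices is first renumbered by all naturals.\<close>
  define z where "z = enumerate Z"
  have z: "strict_mono z" "z k \<in> Z" for k
    using Z by (simp_all add: z_def strict_mono_enumerate enumerate_in_set)
  define w where "w j k = \<bar>u (j - 1) (z k)\<bar> + int k" for j k
  define s where "s j k = (\<lambda>t\<in>{1..l}. if t = 1 then u (j - 1) (z k) else int t * w j k)" for j k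
  define E where "E = {\<lambda>t\<in>{1..l}. \<Sum>j=1..l. s j (\<kappa> j) t | \<kappa> :: nat \<Rightarrow> nat.
               (\<forall>j\<in>{1..l}. 1 \<le> \<kappa> j) \<and> strict_mono_on {1..l} \<kappa>}"
  have large: "abs_to_infinity f" if "\<And>k. int k \<le> \<bar>f k\<bar>" for f
    unfolding abs_to_infinity_def
    by (rule filterlim_at_top_mono[OF filterlim_int_sequentially]) (simp add: that)
  have w_ge: "int k \<le> w j k" "0 \<le> w j k" "\<bar>u (j - 1) (z k)\<bar> + int k \<le> w j k" for j k
    by (simp_all add: w_def)
  have mult_w: "w j k \<le> \<bar>c * w j k\<bar>" if "c \<noteq> 0" for c :: int and j k
    using that w_ge(2)[of j k] mult_right_mono[of 1 "\<bar>c\<bar>" "w j k"] by (simp add: abs_mult)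
  have dom: "int k \<le> \<bar>c * w j k - u (j - 1) (z k)\<bar>" if "c \<noteq> 0" for c :: int and j k
    using mult_w[OF that, of j k] w_ge(3)[of j k] by linarith
  have "is_tilde_Sigma l l E"
    unfolding is_tilde_Sigma_def
  proof (intro exI[of _ s] conjI ballI allI impI)
    show "s j k \<in> int_lattice l" for j k by (simp add: s_def int_lattice_def)
    show "E = {\<lambda>t\<in>{1..l}. \<Sum>j=1..l. s j (\<kappa> j) t | \<kappa> :: nat \<Rightarrow> nat.
               (\<forall>j\<in>{1..l}. 1 \<le> \<kappa> j) \<and> strict_mono_on {1..l} \<kappa>}" by (fact E_def)
    fix j assume j: "j \<in> {1..l}"
    show "abs_to_infinity (\<lambda>k. s j k t)" if t: "t \<in> {1..l}" for t
    proof (cases "t = 1")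
      case True
      have "abs_to_infinity (u (j - 1))" by (rule u) (use j in auto)
      from filterlim_compose[OF this[unfolded abs_to_infinity_def] filterlim_subseq[OF z(1)]]
      show ?thesis using True t by (simp add: s_def abs_to_infinity_def)
    next
      case False
      show ?thesis
      proof (rule large)
        show "int k \<le> \<bar>s j k t\<bar>" for k
          using False t mult_w[of "int t" j k] w_ge(1)[of k j] by (simp add: s_def)
      qed
    qed
    show "abs_to_infinity (\<lambda>k. s j k t - s j k t')"
      if t: "t \<in> {1..l}" "t' \<in> {1..l}" "t \<noteq> t'" for t t'
    proof (rule large)
      fix k
      consider "t = 1" "t' \<noteq> 1" | "t \<noteq> 1" "t' = 1" | "t \<noteq> 1" "t' \<noteq> 1" using t(3) by blast
      then show "int k \<le> \<bar>s j k t - s j k t'\<bar>"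
      proof cases
        case 1
        then show ?thesis using t dom[of "int t'" k j] by (simp add: s_def abs_minus_commute)
      next
        case 2
        then show ?thesis using t dom[of "int t" k j] by (simp add: s_def)
      next
        case 3
        then show ?thesis
          using t mult_w[of "int t - int t'" j k] w_ge(1)[of k j]
          by (simp add: s_def left_diff_distrib)
      qed
    qed
  qed
  moreover define A where "A j = (if j = 0 then A0 else if j = 1 then A1 else space M)" for j :: nat
  have "is_tilde_Sigma_star l l (return_set M T l \<epsilon> A)"
    using A01 \<epsilon> by (intro star) (auto simp: A_def)
  ultimately obtain n where n: "n \<in> return_set M T l \<epsilon> A" "n \<in> E"
    unfolding is_tilde_Sigma_star_def by blast
  obtain \<kappa> where n_eq: "n = (\<lambda>t\<in>{1..l}. \<Sum>j=1..l. s j (\<kappa> j) t)"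
    and \<kappa>: "strict_mono_on {1..l} \<kappa>" using n(2) by (auto simp: E_def)
  define ks where "ks = map (\<lambda>i. z (\<kappa> (Suc i))) [0..<l]"
  have "n 1 = selected_sum u ks"
  proof -
    have "n 1 = (\<Sum>j=1..l. u (j - 1) (z (\<kappa> j)))"
      using assms(1) by (simp add: n_eq s_def)
    also have "\<dots> = (\<Sum>j=1..l. u (j - 1) (ks ! (j - 1)))"
      by (intro sum.cong) (auto simp: ks_def)
    also have "\<dots> = selected_sum u ks"
      by (rule selected_sum_as_indexed_sum[symmetric]) (simp add: ks_def)
    finally show ?thesis .
  qed
  moreover have "ks \<in> increasing_tuples Z l"
  proof -
    have "z (\<kappa> (Suc i)) < z (\<kappa> (Suc j))" if "i < j" "j < l" for i j
      using that by (intro strict_monoD[OF z(1)] strict_mono_onD[OF \<kappa>]) auto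
    then show ?thesis
      using z(2) by (auto simp: increasing_tuples_def ks_def sorted_wrt_iff_nth_less)
  qed
  ultimately have far: "\<epsilon> \<le> \<bar>prob (A0 \<inter> shift (n 1) A1) - prob A0 * prob A1\<bar>" using bad by simp
  have split: "{1..l} = insert 1 {2..l}" "{0..l} = insert 0 (insert 1 {2..l})"
    using assms(1) by auto
  have "A0 \<inter> shift (n 1) A1 \<subseteq> space M" using A01 sets.sets_into_space by blast
  then have "A 0 \<inter> (\<Inter>j\<in>{1..l}. iter (n j) ` A j) = A0 \<inter> shift (n 1) A1"
    unfolding split(1) shift_def[symmetric] by (auto simp: A_def)
  moreover have "(\<Prod>j=0..l. prob (A j)) = prob A0 * prob A1"
    unfolding split(2) by (simp add: A_def prob_space)
  ultimately show False using n(1) far by (simp add: return_set_def)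
qed

end

theorem corollary1p12:
  fixes M :: "'a::metric_space measure" and T :: "'a \<Rightarrow> 'a"
  assumes "invertible_mps M T"
  shows
    "(strongly_mixing M T \<longleftrightarrow>
       (\<forall>l\<ge>1. \<forall>A. (\<forall>j\<in>{0..l}. A j \<in> sets M) \<longrightarrow>
          (\<forall>\<epsilon>>0. is_tilde_Sigma_star l l (return_set M T l \<epsilon> A))))
     \<and>
     (strongly_mixing M T \<longleftrightarrow>
       (\<exists>l\<ge>1. \<forall>A. (\<forall>j\<in>{0..l}. A j \<in> sets M) \<longrightarrow>
          (\<forall>\<epsilon>>0. is_tilde_Sigma_star l l (return_set M T l \<epsilon> A))))"
proof -
  interpret invertible_mps M T by fact
  have "is_tilde_Sigma_star l l (return_set M T l \<epsilon> A)"
    if "strongly_mixing M T" "\<forall>j\<in>{0..l}. A j \<in> sets M" "0 < \<epsilon>" for l A \<epsilon>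
    using strongly_mixing_imp_tilde_Sigma_star that by blast
  moreover have "strongly_mixing M T"
    if "1 \<le> l" "\<forall>A. (\<forall>j\<in>{0..l}. A j \<in> sets M) \<longrightarrow>
      (\<forall>\<epsilon>>0. is_tilde_Sigma_star l l (return_set M T l \<epsilon> A))" for l
    using tilde_Sigma_star_imp_strongly_mixing that by blast
  ultimately show ?thesis by (meson order_refl)
qed

end
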